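(* Let $\mathcal{H}$ be a complex Hilbert space and let $T\in\mathcal{B}(\mathcal{H})$. Then for every $\lambda\in[0,1]$, $$\|M_\lambda(T)\|\le\sqrt{\big\|\lambda^2|T|+(1-\lambda)^2|T^D|\big\|\,\big\|\lambda^2|T^*|+(1-\lambda)^2|(T^D)^*|\big\|}+\lambda(1-\lambda)\sqrt{\big\||T|+|T^D|\big\|\,\big\||T^*|+|(T^D)^*|\big\|}.$$ In particular, $$\|\widehat T\|\le\frac12\sqrt{\big\||T|+|T^D|\big\|\,\big\||T^*|+|(T^D)^*|\big\|}.$$
   Context: $\mathcal{B}(\mathcal{H})$ denotes the bounded linear operators on $\mathcal{H}$. For a bounded operator $S$, $|S|=(S^*S)^{1/2}$. With $T=U|T|$ the canonical polar decomposition ($U$ a partial isometry with $\ker U=\ker T$), the Duggal transform is $T^D=|T|U$, the $\lambda$-mean transform is $M_\lambda(T)=\lambda T+(1-\lambda)T^D$ for $\lambda\in[0,1]$, and the mean transform is $\widehat T=M_{1/2}(T)=\frac12(T+T^D)$. *)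

theory Defs
  imports "HOL-Analysis.Analysis"
begin

text \<open>
  A complex inner product space is a real inner product space carrying in addition a complex
  scalar multiplication and a sesquilinear form, linear in the first argument, whose real part is
  the real inner product. Norm and topology are thus inherited from \<^class>\<open>real_inner\<close>, with
  \<open>(norm x)\<^sup>2 = Re (cinner x x) = cinner x x\<close>.
\<close>

class complex_inner_space = real_inner +
  fixes scaleC :: "complex \<Rightarrow> 'a \<Rightarrow> 'a" (infixr "*\<^sub>C" 75)
    and cinner :: "'a \<Rightarrow> 'a \<Rightarrow> complex"
  assumes scaleC_add_right: "c *\<^sub>C (x + y) = c *\<^sub>C x + c *\<^sub>C y"
    and scaleC_add_left: "(c + d) *\<^sub>C x = c *\<^sub>C x + d *\<^sub>C x"
    and scaleC_scaleC: "c *\<^sub>C d *\<^sub>C x = (c * d) *\<^sub>C x"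
    and scaleC_of_real: "complex_of_real r *\<^sub>C x = r *\<^sub>R x"
    and cinner_commute: "cinner x y = cnj (cinner y x)"
    and cinner_add_left: "cinner (x + y) z = cinner x z + cinner y z"
    and cinner_scaleC_left: "cinner (c *\<^sub>C x) y = c * cinner x y"
    and inner_eq_Re_cinner: "inner x y = Re (cinner x y)"

class complex_hilbert_space = complex_inner_space + banach

text \<open>
  The algebra of bounded complex-linear operators, as a subset of the real-linear ones. The norm
  of \<^typ>\<open>'a \<Rightarrow>\<^sub>L 'a\<close> is the operator norm.
\<close>

definition bounded_ops :: "('a::complex_hilbert_space \<Rightarrow>\<^sub>L 'a) set" where
  "bounded_ops = {T :: 'a \<Rightarrow>\<^sub>L 'a. \<forall>c x. T (c *\<^sub>C x) = c *\<^sub>C T x}"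

definition adjoint_op :: "('a::complex_hilbert_space \<Rightarrow>\<^sub>L 'a) \<Rightarrow> ('a \<Rightarrow>\<^sub>L 'a)" where
  "adjoint_op T = (THE S. S \<in> bounded_ops \<and> (\<forall>x y. cinner (T x) y = cinner x (S y)))"

definition positive_op :: "('a::complex_hilbert_space \<Rightarrow>\<^sub>L 'a) \<Rightarrow> bool" where
  "positive_op P \<longleftrightarrow>
     P \<in> bounded_ops \<and> (\<forall>x. cinner (P x) x \<in> \<real> \<and> 0 \<le> Re (cinner (P x) x))"

definition sqrt_op :: "('a::complex_hilbert_space \<Rightarrow>\<^sub>L 'a) \<Rightarrow> ('a \<Rightarrow>\<^sub>L 'a)" where
  "sqrt_op A = (THE P. positive_op P \<and> P o\<^sub>L P = A)"

definition abs_op :: "('a::complex_hilbert_space \<Rightarrow>\<^sub>L 'a) \<Rightarrow> ('a \<Rightarrow>\<^sub>L 'a)" where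
  "abs_op S = sqrt_op (adjoint_op S o\<^sub>L S)"

definition ker_op :: "('a::complex_hilbert_space \<Rightarrow>\<^sub>L 'a) \<Rightarrow> 'a set" where
  "ker_op T = {x. T x = 0}"

definition partial_isometry :: "('a::complex_hilbert_space \<Rightarrow>\<^sub>L 'a) \<Rightarrow> bool" where
  "partial_isometry U \<longleftrightarrow>
     U \<in> bounded_ops \<and> (\<forall>x. (\<forall>y\<in>ker_op U. cinner x y = 0) \<longrightarrow> norm (U x) = norm x)"

definition polar_factor :: "('a::complex_hilbert_space \<Rightarrow>\<^sub>L 'a) \<Rightarrow> ('a \<Rightarrow>\<^sub>L 'a)" where
  "polar_factor T =
     (THE U. partial_isometry U \<and> ker_op U = ker_op T \<and> T = U o\<^sub>L abs_op T)"

definition duggal_transform :: "('a::complex_hilbert_space \<Rightarrow>\<^sub>L 'a) \<Rightarrow> ('a \<Rightarrow>\<^sub>L 'a)" where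
  "duggal_transform T = abs_op T o\<^sub>L polar_factor T"

definition lambda_mean_transform ::
    "real \<Rightarrow> ('a::complex_hilbert_space \<Rightarrow>\<^sub>L 'a) \<Rightarrow> ('a \<Rightarrow>\<^sub>L 'a)" where
  "lambda_mean_transform l T = l *\<^sub>R T + (1 - l) *\<^sub>R duggal_transform T"

definition mean_transform :: "('a::complex_hilbert_space \<Rightarrow>\<^sub>L 'a) \<Rightarrow> ('a \<Rightarrow>\<^sub>L 'a)" where
  "mean_transform T = lambda_mean_transform (1/2) T"

end

theory Submission
  imports Defs
begin

text \<open>
  The inequality holds for any pair of bounded operators \<open>T\<close>, \<open>D\<close> in place of \<open>T\<close>, \<open>T\<^sup>D\<close>. Writing
  \<open>l = l\<^sup>2 + l (1 - l)\<close> and \<open>1 - l = (1 - l)\<^sup>2 + l (1 - l)\<close>, one splits \<open>\<langle>(l T + (1 - l) D) x, y\<rangle>\<close> into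
  \<open>l\<^sup>2 \<langle>T x, y\<rangle> + (1 - l)\<^sup>2 \<langle>D x, y\<rangle>\<close> and \<open>l (1 - l) (\<langle>T x, y\<rangle> + \<langle>D x, y\<rangle>)\<close>. Each part is bounded by
  the mixed Schwarz inequality \<open>|\<langle>T x, y\<rangle>|\<^sup>2 \<le> \<langle>|T| x, x\<rangle> \<langle>|T\<^sup>*| y, y\<rangle>\<close> followed by the Cauchy-Schwarz
  inequality in the plane. For \<open>l = 1/2\<close> the two resulting terms coincide. Since a complex-linear
  operator is determined by the real parts of its matrix coefficients, adjoints, square roots and
  polar decompositions are obtained from the underlying real Hilbert space.
\<close>

section \<open>Bounded operators on real Hilbert spaces\<close>

text \<open>The discriminant criterion, for arbitrary real \<open>c\<close>: nonnegativity on the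
  whole line excludes \<open>c < 0\<close>, and in the degenerate case \<open>c = 0\<close> it
  forces \<open>b = 0\<close>. It turns nonnegative quadratic forms into Cauchy-Schwarz
  inequalities.\<close>

lemma square_le_product_of_quadratic_nonneg:
  fixes a b c :: real
  assumes nn: "\<And>t. 0 \<le> a + 2 * t * b + t\<^sup>2 * c"
  shows "b\<^sup>2 \<le> a * c"
proof (cases "c = 0")
  case True
  have "b = 0"
  proof (rule ccontr)
    assume "b \<noteq> 0"
    then have "a + 2 * (- (a + 1) / (2 * b)) * b + (- (a + 1) / (2 * b))\<^sup>2 * c = -1"
      using True by (simp add: field_simps)
    with nn[of "- (a + 1) / (2 * b)"] show False by linarith
  qed
  with True show ?thesis by simp
next
  case False
  \<comment> \<open>Adding the values at \<open>t\<close> and \<open>- t\<close> cancels the linear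
    term.\<close>
  have "0 \<le> a + t\<^sup>2 * c" for t :: real
    using nn[of t] nn[of "- t"] by simp
  have "c > 0"
  proof (rule ccontr)
    assume "\<not> c > 0"
    with False have "c < 0" by simp
    \<comment> \<open>This choice makes \<open>t * c\<close> smaller than
      \<open>- \<bar>a\<bar> - 1\<close>; the final summand 1 ensures \<open>t \<ge> 1\<close>, so
      that squaring \<open>t\<close> only lowers the value further.\<close>
    define t where "t = (\<bar>a\<bar> + 1) / (- c) + 1"
    have "t \<ge> 1" using \<open>c < 0\<close> by (simp add: t_def divide_nonneg_neg)
    then have "t \<le> t\<^sup>2" by (simp add: power2_eq_square)
    then have "t\<^sup>2 * c \<le> t * c" using \<open>c < 0\<close> by simp
    also have "t * c = - (\<bar>a\<bar> + 1) + c" using \<open>c < 0\<close> by (simp add: t_def field_simps)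
    finally show False using \<open>c < 0\<close> \<open>0 \<le> a + t\<^sup>2 * c\<close> by linarith
  qed
  have "a + 2 * (- b / c) * b + (- b / c)\<^sup>2 * c = a - b\<^sup>2 / c"
    using \<open>c > 0\<close> by (simp add: field_simps power2_eq_square)
  with nn[of "- b / c"] have "b\<^sup>2 / c \<le> a" by linarith
  with \<open>c > 0\<close> show ?thesis by (simp add: field_simps)
qed

lemma closure_inter_orthogonal_eq_zero:
  fixes m :: "'a::real_inner"
  assumes "m \<in> closure S" and "\<And>z. z \<in> S \<Longrightarrow> m \<bullet> z = 0"
  shows "m = 0"
proof -
  have "closed {z. m \<bullet> z = 0}"
    by (intro closed_Collect_eq continuous_intros)
  then have "closure S \<subseteq> {z. m \<bullet> z = 0}"
    using assms(2) by (intro closure_minimal) auto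
  with assms(1) show ?thesis by auto
qed

text \<open>With \<open>A = id\<close> this is the Riesz representation theorem; with \<open>g = (\<lambda>x. z \<bullet> A x)\<close> it gives the
  orthogonal projection of \<open>z\<close> onto the closed range of \<open>A\<close>. The representing vector is the limit
  of \<open>A x\<^sub>n\<close> for a sequence minimising \<open>(norm (A x))\<^sup>2 - 2 * g x\<close>.\<close>

lemma riesz_representation_range:
  fixes A :: "'b::real_vector \<Rightarrow> 'a::{real_inner,banach}"
  assumes A: "linear A" and g: "linear g" and bd: "\<And>x. \<bar>g x\<bar> \<le> C * norm (A x)"
  obtains m where "m \<in> closure (range A)" "\<And>x. g x = m \<bullet> A x"
proof -
  define J where "J x = (norm (A x))\<^sup>2 - 2 * g x" for x
  have J_lower: "- C\<^sup>2 \<le> J x" for x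
  proof -
    have "2 * g x \<le> 2 * C * norm (A x)" using bd[of x] by simp
    moreover have "0 \<le> (norm (A x) - C)\<^sup>2" by simp
    ultimately show ?thesis unfolding J_def power2_diff by (simp add: algebra_simps)
  qed
  define d where "d = Inf (range J)"
  have bdd: "bdd_below (range J)" using J_lower by (intro bdd_belowI2)
  have d_le: "d \<le> J x" for x unfolding d_def using bdd by (simp add: cInf_lower)
  have "\<exists>x. J x < d + 1 / Suc n" for n
  proof -
    have "Inf (range J) < d + 1 / Suc n" by (simp add: d_def)
    then show ?thesis using cInf_lessD[of "range J"] by auto
  qed
  then obtain X where X: "\<And>n. J (X n) < d + 1 / Suc n" by metis
  \<comment> \<open>Since \<open>J\<close> is at least \<open>d\<close> at the midpoint, two
    near-minimisers of \<open>J\<close> must have close images under \<open>A\<close>.\<close>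
  have parallelogram:
    "(norm (A x - A y))\<^sup>2 = 2 * J x + 2 * J y - 4 * J ((1/2) *\<^sub>R (x + y))" for x y
    unfolding J_def power2_norm_eq_inner
    using A g by (simp add: linear_add linear_scale algebra_simps inner_commute)
  have "Cauchy (\<lambda>n. A (X n))"
  proof (rule metric_CauchyI)
    fix e :: real
    assume "0 < e"
    then obtain M where M: "4 / e\<^sup>2 < real M" using reals_Archimedean2 by blast
    have "dist (A (X m)) (A (X n)) < e" if "m \<ge> M" "n \<ge> M" for m n
    proof -
      have M0: "real M > 0" using M \<open>0 < e\<close> by (smt (verit) zero_less_divide_iff zero_less_power)
      have le: "1 / real (Suc k) \<le> 1 / real M" if "k \<ge> M" for k
        using that M0 by (intro divide_left_mono) auto
      have "(norm (A (X m) - A (X n)))\<^sup>2 < 4 * (1 / real M)"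
        using parallelogram[of "X m" "X n"] X[of m] X[of n] d_le[of "(1/2) *\<^sub>R (X m + X n)"]
          le[OF that(1)] le[OF that(2)] by linarith
      also have "\<dots> < e\<^sup>2" using M M0 \<open>0 < e\<close> by (simp add: field_simps)
      finally show ?thesis using \<open>0 < e\<close> by (simp add: dist_norm power_less_imp_less_base)
    qed
    then show "\<exists>M. \<forall>m\<ge>M. \<forall>n\<ge>M. dist (A (X m)) (A (X n)) < e" by blast
  qed
  then obtain m where m: "(\<lambda>n. A (X n)) \<longlonglongrightarrow> m"
    using Cauchy_convergent_iff convergent_def by blast
  have "m \<in> closure (range A)"
    unfolding closure_sequential using m by (intro exI[of _ "\<lambda>n. A (X n)"]) auto
  moreover have "g x = m \<bullet> A x" for x
  proof -
    \<comment> \<open>First variation: moving from \<open>X n\<close> to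
      \<open>X n + t *\<^sub>R x\<close> lowers \<open>J\<close> by less than
      \<open>1 / Suc n\<close>. In the limit the quadratic in \<open>t\<close> has constant term 0,
      so its linear coefficient must vanish.\<close>
    have "0 \<le> 0 + 2 * t * (m \<bullet> A x - g x) + t\<^sup>2 * (norm (A x))\<^sup>2" for t
    proof (rule LIMSEQ_le_const)
      show "(\<lambda>n. 1 / Suc n + 2 * t * (A (X n) \<bullet> A x - g x) + t\<^sup>2 * (norm (A x))\<^sup>2)
            \<longlonglongrightarrow> 0 + 2 * t * (m \<bullet> A x - g x) + t\<^sup>2 * (norm (A x))\<^sup>2"
        by (intro tendsto_intros m LIMSEQ_Suc[OF lim_1_over_n])
      have "0 \<le> 1 / Suc n + 2 * t * (A (X n) \<bullet> A x - g x) + t\<^sup>2 * (norm (A x))\<^sup>2" for n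
      proof -
        have "J (X n + t *\<^sub>R x) = J (X n) + 2 * t * (A (X n) \<bullet> A x - g x) + t\<^sup>2 * (norm (A x))\<^sup>2"
          unfolding J_def power2_norm_eq_inner
          using A g by (simp add: linear_add linear_scale algebra_simps inner_commute power2_eq_square)
        with X[of n] d_le[of "X n + t *\<^sub>R x"] show ?thesis by linarith
      qed
      then show "\<exists>N. \<forall>n\<ge>N. 0 \<le> 1 / Suc n + 2 * t * (A (X n) \<bullet> A x - g x) + t\<^sup>2 * (norm (A x))\<^sup>2"
        by blast
    qed
    then have "(m \<bullet> A x - g x)\<^sup>2 \<le> 0 * (norm (A x))\<^sup>2"
      by (rule square_le_product_of_quadratic_nonneg)
    then show ?thesis by simp
  qed
  ultimately show thesis by (rule that)
qed

lemma subspace_closure: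
  fixes S :: "'a::real_normed_vector set"
  assumes "subspace S"
  shows "subspace (closure S)"
  unfolding subspace_def
proof (intro conjI ballI allI)
  show "0 \<in> closure S" using assms closure_subset subspace_0 by blast
  show "x + y \<in> closure S" if "x \<in> closure S" "y \<in> closure S" for x y
  proof -
    from that obtain f g where "\<forall>n. f n \<in> S" "f \<longlonglongrightarrow> x" "\<forall>n. g n \<in> S" "g \<longlonglongrightarrow> y"
      unfolding closure_sequential by blast
    then show ?thesis unfolding closure_sequential
      by (intro exI[of _ "\<lambda>n. f n + g n"]) (simp add: tendsto_add subspace_add[OF assms])
  qed
  show "c *\<^sub>R x \<in> closure S" if "x \<in> closure S" for c x
  proof -
    from that obtain f where "\<forall>n. f n \<in> S" "f \<longlonglongrightarrow> x"
      unfolding closure_sequential by blast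
    then show ?thesis unfolding closure_sequential
      by (intro exI[of _ "\<lambda>n. c *\<^sub>R f n"]) (simp add: tendsto_scaleR subspace_scale[OF assms])
  qed
qed

lemma subspace_closure_range_blinfun: "subspace (closure (range (blinfun_apply A)))"
  by (intro subspace_closure linear_subspace_image subspace_UNIV bounded_linear.linear
      blinfun.bounded_linear_right)

text \<open>The domination makes \<open>A x \<mapsto> T x\<close> a well-defined bounded map on the
  range of \<open>A\<close>; \<open>W\<close> is the adjoint of its continuous extension to the
  closed range, obtained value by value from the Riesz theorem. The identity as \<open>A\<close>
  yields real adjoints, |T| as \<open>A\<close> yields the adjoint of the polar factor.\<close>

lemma blinfun_factor_through_range:
  fixes A :: "'b::real_normed_vector \<Rightarrow>\<^sub>L 'a::{real_inner,banach}"
    and T :: "'b \<Rightarrow>\<^sub>L 'c::real_inner"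
  assumes le: "\<And>x. norm (T x) \<le> C * norm (A x)" and C: "0 \<le> C"
  obtains W :: "'c \<Rightarrow>\<^sub>L 'a"
  where "\<And>y. W y \<in> closure (range A)" "\<And>x y. y \<bullet> T x = W y \<bullet> A x"
proof -
  have "\<exists>m. m \<in> closure (range A) \<and> (\<forall>x. y \<bullet> T x = m \<bullet> A x)" for y
  proof (rule riesz_representation_range[of "blinfun_apply A" "\<lambda>x. y \<bullet> T x" "norm y * C"])
    show "linear (blinfun_apply A)" by (simp add: bounded_linear.linear blinfun.bounded_linear_right)
    show "linear (\<lambda>x. y \<bullet> T x)"
      by (rule linearI) (simp_all add: blinfun.add_right blinfun.scaleR_right inner_add_right)
    show "\<bar>y \<bullet> T x\<bar> \<le> norm y * C * norm (A x)" for x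
      using order_trans[OF Cauchy_Schwarz_ineq2 mult_left_mono[OF le norm_ge_zero]]
      by (simp add: mult.assoc)
  qed blast
  then obtain w where w_in: "\<And>y. w y \<in> closure (range A)" and w: "\<And>x y. y \<bullet> T x = w y \<bullet> A x"
    by metis
  have sub: "subspace (closure (range A))" by (rule subspace_closure_range_blinfun)
  have w': "w y \<bullet> A x = y \<bullet> T x" for x y by (simp add: w)
  have uniq: "m = w y" if "m \<in> closure (range A)" "\<And>x. y \<bullet> T x = m \<bullet> A x" for m y
  proof -
    have "m - w y = 0"
      using that w_in[of y] w[of y] sub
      by (intro closure_inter_orthogonal_eq_zero[of _ "range A"])
         (auto simp: subspace_diff inner_diff_left)
    then show ?thesis by simp
  qed
  \<comment> \<open>The estimate of the functional on the range extends to the closure, where it can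
    be evaluated at \<open>w y\<close> itself.\<close>
  have bound: "norm (w y) \<le> norm y * C" for y
  proof -
    have "closed {z. w y \<bullet> z \<le> norm y * C * norm z}"
      by (intro closed_Collect_le continuous_intros)
    moreover have "w y \<bullet> A x \<le> norm y * C * norm (A x)" for x
    proof -
      have "w y \<bullet> A x = y \<bullet> T x" using w by simp
      also have "\<dots> \<le> norm y * norm (T x)" by (rule norm_cauchy_schwarz)
      also have "\<dots> \<le> norm y * (C * norm (A x))" by (intro mult_left_mono le) simp
      finally show ?thesis by (simp add: mult.assoc)
    qed
    ultimately have "closure (range A) \<subseteq> {z. w y \<bullet> z \<le> norm y * C * norm z}"
      by (intro closure_minimal) auto
    with w_in[of y] have "w y \<bullet> w y \<le> norm y * C * norm (w y)" by blast
    then have "norm (w y) * norm (w y) \<le> norm y * C * norm (w y)"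
      by (simp add: power2_norm_eq_inner[symmetric] power2_eq_square)
    then show ?thesis
      by (cases "w y = 0") (use C in \<open>simp_all add: mult_le_cancel_right\<close>)
  qed
  have "bounded_linear w"
  proof (rule bounded_linear_intro)
    show "w (x + y) = w x + w y" for x y
      using w_in sub by (intro uniq[symmetric]) (auto simp: subspace_add inner_add_left w')
    show "w (r *\<^sub>R x) = r *\<^sub>R w x" for r x
      using w_in sub by (intro uniq[symmetric]) (auto simp: subspace_scale w')
  qed (rule bound)
  then have "blinfun_apply (Blinfun w) = w" by (rule bounded_linear_Blinfun_apply)
  with w w_in that[of "Blinfun w"] show thesis by simp
qed

lemma real_adjoint_exists:
  fixes T :: "'a::{real_inner,banach} \<Rightarrow>\<^sub>L 'b::real_inner"
  obtains S :: "'b \<Rightarrow>\<^sub>L 'a" where "\<And>x y. T x \<bullet> y = x \<bullet> S y"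
proof -
  have "norm (T x) \<le> norm T * norm (id_blinfun x)" for x by (simp add: norm_blinfun)
  from blinfun_factor_through_range[OF this] obtain S :: "'b \<Rightarrow>\<^sub>L 'a"
    where "\<And>x y. y \<bullet> T x = S y \<bullet> id_blinfun x" by auto
  then have "\<And>x y. T x \<bullet> y = x \<bullet> S y" by (simp add: inner_commute)
  then show thesis by (rule that)
qed

lemma orthogonal_decomposition_range:
  fixes A :: "'b::real_normed_vector \<Rightarrow>\<^sub>L 'a::{real_inner,banach}"
  obtains p where "p \<in> closure (range A)" "\<And>x. (z - p) \<bullet> A x = 0"
proof -
  obtain p where "p \<in> closure (range A)" "\<And>x. z \<bullet> A x = p \<bullet> A x"
  proof (rule riesz_representation_range[of "blinfun_apply A" "\<lambda>x. z \<bullet> A x" "norm z"])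
    show "linear (blinfun_apply A)" by (simp add: bounded_linear.linear blinfun.bounded_linear_right)
    show "linear (\<lambda>x. z \<bullet> A x)"
      by (rule linearI) (simp_all add: blinfun.add_right blinfun.scaleR_right inner_add_right)
  qed (auto simp: Cauchy_Schwarz_ineq2)
  then show thesis by (intro that) (simp_all add: inner_diff_left)
qed

section \<open>Square roots of positive operators\<close>

text \<open>Symmetry is demanded explicitly because over the reals it does not follow from
  nonnegativity of the quadratic form.\<close>

definition nonneg_op :: "('a::real_inner \<Rightarrow>\<^sub>L 'a) \<Rightarrow> bool" where
  "nonneg_op P \<longleftrightarrow> (\<forall>x y. P x \<bullet> y = x \<bullet> P y) \<and> (\<forall>x. 0 \<le> P x \<bullet> x)"

lemma nonneg_op_symmetric: "nonneg_op P \<Longrightarrow> P x \<bullet> y = x \<bullet> P y"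
  by (simp add: nonneg_op_def)

lemma nonneg_op_nonneg: "nonneg_op P \<Longrightarrow> 0 \<le> P x \<bullet> x"
  unfolding nonneg_op_def by blast

lemma nonneg_op_Cauchy_Schwarz:
  assumes "nonneg_op P"
  shows "(P x \<bullet> y)\<^sup>2 \<le> (P x \<bullet> x) * (P y \<bullet> y)"
proof (rule square_le_product_of_quadratic_nonneg)
  fix t :: real
  have "P y \<bullet> x = P x \<bullet> y" using assms by (simp add: nonneg_op_def inner_commute)
  then have "P (x + t *\<^sub>R y) \<bullet> (x + t *\<^sub>R y)
      = P x \<bullet> x + 2 * t * (P x \<bullet> y) + t\<^sup>2 * (P y \<bullet> y)"
    by (simp add: blinfun.add_right blinfun.scaleR_right algebra_simps power2_eq_square)
  then show "0 \<le> P x \<bullet> x + 2 * t * (P x \<bullet> y) + t\<^sup>2 * (P y \<bullet> y)"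
    using assms by (metis nonneg_op_def)
qed

lemma nonneg_op_apply_eq_zero:
  assumes "nonneg_op P" and "P x \<bullet> x = 0"
  shows "P x = 0"
  using nonneg_op_Cauchy_Schwarz[OF assms(1), of x "P x"] assms(2) by simp

lemma inner_blinfun_le_norm:
  fixes P :: "'a::real_inner \<Rightarrow>\<^sub>L 'a"
  shows "P x \<bullet> x \<le> norm P * (norm x)\<^sup>2"
proof -
  have "P x \<bullet> x \<le> norm (P x) * norm x" by (rule norm_cauchy_schwarz)
  also have "\<dots> \<le> norm P * norm x * norm x" by (intro mult_right_mono norm_blinfun) simp
  finally show ?thesis by (simp add: power2_eq_square mult.assoc)
qed

text \<open>Cauchy-Schwarz for the form of \<open>P\<close> at the pair \<open>x\<close>,
  \<open>P x\<close> bounds the fourth power of \<open>norm (P x)\<close> by the product of the form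
  at \<open>x\<close> and at \<open>P x\<close>; the hypothesis applies to both factors.\<close>

lemma nonneg_op_norm_le_one:
  assumes P: "nonneg_op P" and le: "\<And>x. P x \<bullet> x \<le> (norm x)\<^sup>2"
  shows "norm P \<le> 1"
proof (rule norm_blinfun_bound)
  fix x
  have "((norm (P x))\<^sup>2)\<^sup>2 \<le> (P x \<bullet> x) * (P (P x) \<bullet> P x)"
    using nonneg_op_Cauchy_Schwarz[OF P, of x "P x"] by (simp add: power2_norm_eq_inner)
  also have "\<dots> \<le> (norm x)\<^sup>2 * (norm (P x))\<^sup>2"
    using nonneg_op_nonneg[OF P] by (intro mult_mono le) (simp_all add: power2_norm_eq_inner)
  finally have "(norm (P x))\<^sup>2 * (norm (P x))\<^sup>2 \<le> (norm x)\<^sup>2 * (norm (P x))\<^sup>2"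
    by (simp add: power2_eq_square)
  then have "P x = 0 \<or> (norm (P x))\<^sup>2 \<le> (norm x)\<^sup>2"
    unfolding mult_le_cancel_right by (metis norm_eq_zero zero_le_power2 zero_less_power2)
  then show "norm (P x) \<le> 1 * norm x" by (auto simp: power2_le_iff_abs_le)
qed simp

text \<open>A fixed point \<open>Y\<close> of \<open>Y \<mapsto> (K + Y\<^sup>2) / 2\<close> satisfies \<open>(1 - Y)\<^sup>2 = 1 - K\<close>. When \<open>norm K \<le> 1\<close> the
  iteration is majorised, increments included, by the scalar one with \<open>K = 1\<close>, so that it
  converges in operator norm.\<close>

primrec sqrt_iter :: "('a::real_normed_vector \<Rightarrow>\<^sub>L 'a) \<Rightarrow> nat \<Rightarrow> ('a \<Rightarrow>\<^sub>L 'a)" where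
  "sqrt_iter K 0 = 0"
| "sqrt_iter K (Suc n) = (1/2) *\<^sub>R (K + (sqrt_iter K n o\<^sub>L sqrt_iter K n))"

primrec sqrt_iter_bound :: "nat \<Rightarrow> real" where
  "sqrt_iter_bound 0 = 0"
| "sqrt_iter_bound (Suc n) = (1 + (sqrt_iter_bound n)\<^sup>2) / 2"

lemma sqrt_iter_bound_range: "0 \<le> sqrt_iter_bound n \<and> sqrt_iter_bound n \<le> 1"
  by (induction n) (auto simp: power_le_one)

lemma sqrt_iter_bound_incseq: "incseq sqrt_iter_bound"
proof (rule incseq_SucI)
  fix n
  have "0 \<le> (1 - sqrt_iter_bound n)\<^sup>2" by simp
  then show "sqrt_iter_bound n \<le> sqrt_iter_bound (Suc n)" by (simp add: power2_diff)
qed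

lemma norm_sqrt_iter:
  assumes "norm K \<le> 1"
  shows "norm (sqrt_iter K n) \<le> sqrt_iter_bound n"
proof (induction n)
  case (Suc n)
  have "norm (sqrt_iter K n o\<^sub>L sqrt_iter K n) \<le> norm (sqrt_iter K n) * norm (sqrt_iter K n)"
    by (rule norm_blinfun_compose)
  also have "\<dots> \<le> (sqrt_iter_bound n)\<^sup>2"
    unfolding power2_eq_square using Suc sqrt_iter_bound_range[of n] by (intro mult_mono) auto
  finally show ?case
    using norm_triangle_ineq[of K "sqrt_iter K n o\<^sub>L sqrt_iter K n"] assms by simp
qed simp

lemma norm_sqrt_iter_Suc_diff:
  assumes K: "norm K \<le> 1"
  shows "norm (sqrt_iter K (Suc n) - sqrt_iter K n) \<le> sqrt_iter_bound (Suc n) - sqrt_iter_bound n"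
proof (induction n)
  case 0
  show ?case using K by simp
next
  case (Suc n)
  define Y Z where "Y = sqrt_iter K n" and "Z = sqrt_iter K (Suc n)"
  define y z where "y = sqrt_iter_bound n" and "z = sqrt_iter_bound (Suc n)"
  have IH: "norm (Z - Y) \<le> z - y" using Suc by (simp only: Y_def Z_def y_def z_def)
  have nY: "norm Y \<le> y" and nZ: "norm Z \<le> z"
    unfolding Y_def Z_def y_def z_def by (intro norm_sqrt_iter K)+
  have zy: "0 \<le> z - y" using IH norm_ge_zero order_trans by blast
  \<comment> \<open>The difference of squares is split as Z (Z - Y) + (Z - Y) Y, which is valid
    without commutativity and has \<open>z\<^sup>2 - y\<^sup>2\<close> as its scalar
    counterpart.\<close>
  have eq: "sqrt_iter K (Suc (Suc n)) - sqrt_iter K (Suc n)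
      = (1/2) *\<^sub>R ((Z o\<^sub>L (Z - Y)) + ((Z - Y) o\<^sub>L Y))"
    unfolding sqrt_iter.simps(2)[of K "Suc n"] Z_def[symmetric]
    by (subst (3) Z_def) (simp add: Y_def[symmetric] blinfun_eqI blinfun.bilinear_simps algebra_simps)
  have "norm (Z o\<^sub>L (Z - Y)) \<le> z * (z - y)"
    by (intro order_trans[OF norm_blinfun_compose] mult_mono nZ IH)
       (use sqrt_iter_bound_range in \<open>auto simp: z_def\<close>)
  moreover have "norm ((Z - Y) o\<^sub>L Y) \<le> (z - y) * y"
    by (intro order_trans[OF norm_blinfun_compose] mult_mono nY IH zy) simp
  ultimately have "norm (sqrt_iter K (Suc (Suc n)) - sqrt_iter K (Suc n))
      \<le> (z * (z - y) + (z - y) * y) / 2"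
    unfolding eq using norm_triangle_ineq[of "Z o\<^sub>L (Z - Y)" "(Z - Y) o\<^sub>L Y"] by simp
  also have "\<dots> = (1 + z\<^sup>2) / 2 - (1 + y\<^sup>2) / 2" by (simp add: power2_eq_square field_simps)
  also have "\<dots> = sqrt_iter_bound (Suc (Suc n)) - sqrt_iter_bound (Suc n)"
    by (simp add: y_def z_def)
  finally show ?case .
qed

lemma sqrt_iter_convergent:
  fixes K :: "'a::banach \<Rightarrow>\<^sub>L 'a"
  assumes K: "norm K \<le> 1"
  shows "convergent (sqrt_iter K)"
proof -
  have "convergent sqrt_iter_bound"
    using sqrt_iter_bound_incseq sqrt_iter_bound_range
    by (intro Bseq_monoseq_convergent BseqI'[of _ 1]) (auto simp: incseq_imp_monoseq)
  then have "summable (\<lambda>n. sqrt_iter_bound (Suc n) - sqrt_iter_bound n)"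
    unfolding convergent_def using telescope_summable by blast
  then have "summable (\<lambda>n. sqrt_iter K (Suc n) - sqrt_iter K n)"
    by (rule summable_comparison_test[rotated])
       (use norm_sqrt_iter_Suc_diff[OF K] in blast)
  then show ?thesis
    by (simp add: summable_iff_convergent sum_lessThan_telescope del: sqrt_iter.simps(2))
qed

text \<open>After rescaling, the limit \<open>Y\<close> of the iteration for \<open>K\<close> = 1 -
  A/s gives the root as \<open>sqrt s\<close> times 1 - Y. Every iterate is a polynomial in
  \<open>A\<close>, so whatever commutes with \<open>A\<close> commutes with \<open>P\<close>; this
  last clause later yields uniqueness and complex linearity.\<close>

lemma nonneg_op_sqrt_exists:
  fixes A :: "'a::{real_inner,banach} \<Rightarrow>\<^sub>L 'a"
  assumes A: "nonneg_op A"
  obtains P where "nonneg_op P" "P o\<^sub>L P = A"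
    "\<And>C. A o\<^sub>L C = C o\<^sub>L A \<Longrightarrow> P o\<^sub>L C = C o\<^sub>L P"
proof -
  \<comment> \<open>The summand 1 keeps \<open>s\<close> positive when \<open>A = 0\<close>.\<close>
  define s where "s = norm A + 1"
  have s: "s > 0" using norm_ge_zero[of A] by (simp add: s_def add_nonneg_pos)
  define K where "K = id_blinfun - (1 / s) *\<^sub>R A"
  have K_apply: "K x = x - (1 / s) *\<^sub>R A x" for x by (simp add: K_def blinfun.bilinear_simps)
  have "nonneg_op K" and K_le: "K x \<bullet> x \<le> (norm x)\<^sup>2" for x
  proof -
    have "A x \<bullet> x \<le> s * (norm x)\<^sup>2" for x
      using inner_blinfun_le_norm[of A x] zero_le_power2[of "norm x"]
      unfolding s_def distrib_right by linarith
    then show "nonneg_op K" using A s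
      by (auto simp: nonneg_op_def K_apply inner_diff_left inner_diff_right power2_norm_eq_inner
          field_simps)
    show "K x \<bullet> x \<le> (norm x)\<^sup>2" using A s
      by (auto simp: nonneg_op_def K_apply inner_diff_left power2_norm_eq_inner)
  qed
  then have K: "norm K \<le> 1" by (intro nonneg_op_norm_le_one)
  from sqrt_iter_convergent[OF K] obtain Y where Y: "sqrt_iter K \<longlonglongrightarrow> Y"
    by (auto simp: convergent_def)
  have Y_apply: "(\<lambda>n. sqrt_iter K n x) \<longlonglongrightarrow> Y x" for x
    by (intro blinfun.tendsto Y tendsto_const)
  have "(\<lambda>n. (1/2) *\<^sub>R (K + (sqrt_iter K n o\<^sub>L sqrt_iter K n))) \<longlonglongrightarrow> (1/2) *\<^sub>R (K + (Y o\<^sub>L Y))"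
    by (intro tendsto_intros bounded_bilinear.tendsto[OF bounded_bilinear_blinfun_compose] Y)
  moreover have "(\<lambda>n. sqrt_iter K (Suc n)) \<longlonglongrightarrow> Y" using Y by (rule LIMSEQ_Suc)
  ultimately have Y_fix: "Y = (1/2) *\<^sub>R (K + (Y o\<^sub>L Y))"
    unfolding sqrt_iter.simps using LIMSEQ_unique by blast
  have Y_sa: "Y x \<bullet> y = x \<bullet> Y y" for x y
  proof -
    have "sqrt_iter K n x \<bullet> y = x \<bullet> sqrt_iter K n y" for n x y
      by (induction n arbitrary: x y)
         (simp_all add: blinfun.bilinear_simps nonneg_op_symmetric[OF \<open>nonneg_op K\<close>]
           inner_add_left inner_add_right)
    moreover have "(\<lambda>n. sqrt_iter K n x \<bullet> y) \<longlonglongrightarrow> Y x \<bullet> y" "(\<lambda>n. x \<bullet> sqrt_iter K n y) \<longlonglongrightarrow> x \<bullet> Y y"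
      by (intro tendsto_intros Y_apply)+
    ultimately show ?thesis using LIMSEQ_unique by simp
  qed
  have Y_norm: "norm Y \<le> 1"
    by (rule LIMSEQ_le_const2[OF tendsto_norm[OF Y]])
       (use norm_sqrt_iter[OF K] sqrt_iter_bound_range order_trans in blast)
  have Y_comm: "Y (C x) = C (Y x)" if "A o\<^sub>L C = C o\<^sub>L A" for C x
  proof -
    have "A (C x) = C (A x)" for x using arg_cong[OF that, of "\<lambda>B. blinfun_apply B x"] by simp
    then have "sqrt_iter K n (C x) = C (sqrt_iter K n x)" for n x
      by (induction n arbitrary: x) (simp_all add: blinfun.bilinear_simps K_apply)
    moreover have "(\<lambda>n. sqrt_iter K n (C x)) \<longlonglongrightarrow> Y (C x)" "(\<lambda>n. C (sqrt_iter K n x)) \<longlonglongrightarrow> C (Y x)"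
      by (intro Y_apply blinfun.tendsto tendsto_const)+
    ultimately show ?thesis using LIMSEQ_unique by simp
  qed
  define P where "P = sqrt s *\<^sub>R (id_blinfun - Y)"
  have P_apply: "P x = sqrt s *\<^sub>R (x - Y x)" for x by (simp add: P_def blinfun.bilinear_simps)
  have "Y x \<bullet> x \<le> x \<bullet> x" for x
    using inner_blinfun_le_norm[of Y x] mult_right_mono[OF Y_norm zero_le_power2[of "norm x"]]
    by (simp add: power2_norm_eq_inner)
  then have "nonneg_op P"
    using s by (auto simp: nonneg_op_def P_apply inner_diff_left inner_diff_right Y_sa)
  moreover have "P o\<^sub>L P = A"
  proof (rule blinfun_eqI)
    fix x
    have "2 *\<^sub>R Y x = K x + Y (Y x)"
      by (subst Y_fix) (simp add: blinfun.bilinear_simps)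
    then have "x - 2 *\<^sub>R Y x + Y (Y x) = (1 / s) *\<^sub>R A x" by (simp add: K_apply)
    then have "s *\<^sub>R (x - 2 *\<^sub>R Y x + Y (Y x)) = A x" using s by simp
    moreover have "(P o\<^sub>L P) x = s *\<^sub>R (x - 2 *\<^sub>R Y x + Y (Y x))"
      using s by (simp add: P_apply blinfun.bilinear_simps scaleR_2 algebra_simps)
    ultimately show "(P o\<^sub>L P) x = A x" by simp
  qed
  moreover have "P o\<^sub>L C = C o\<^sub>L P" if "A o\<^sub>L C = C o\<^sub>L A" for C
    by (rule blinfun_eqI) (simp add: P_apply blinfun.bilinear_simps Y_comm[OF that])
  ultimately show thesis by (rule that)
qed

text \<open>Commutation and equal squares give (S + Q)(S - Q) = 0. For \<open>y = S x - Q x\<close>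
  the two nonnegative forms therefore sum to zero, so \<open>S\<close> and \<open>Q\<close> both
  kill \<open>y\<close>, and by symmetry \<open>y \<bullet> y\<close> = 0.\<close>

lemma nonneg_op_commuting_sqrt_unique:
  assumes S: "nonneg_op S" and Q: "nonneg_op Q"
    and sq: "S o\<^sub>L S = Q o\<^sub>L Q" and comm: "S o\<^sub>L Q = Q o\<^sub>L S"
  shows "S = Q"
proof (rule blinfun_eqI)
  fix x
  have app: "S (S x) = Q (Q x)" "S (Q x) = Q (S x)" for x
    using arg_cong[OF sq, of "\<lambda>B. blinfun_apply B x"] arg_cong[OF comm, of "\<lambda>B. blinfun_apply B x"]
    by simp_all
  define y where "y = S x - Q x"
  have "S y + Q y = 0" by (simp add: y_def blinfun.bilinear_simps app)
  then have "S y \<bullet> y + Q y \<bullet> y = 0" by (metis inner_add_left inner_zero_left)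
  moreover have "0 \<le> S y \<bullet> y" "0 \<le> Q y \<bullet> y" by (rule nonneg_op_nonneg[OF S], rule nonneg_op_nonneg[OF Q])
  ultimately have "S y = 0" "Q y = 0" using S Q by (simp_all add: nonneg_op_apply_eq_zero)
  moreover have "y \<bullet> y = x \<bullet> (S y - Q y)"
    using S Q unfolding nonneg_op_def by (subst y_def) (simp add: inner_diff_left inner_diff_right)
  ultimately show "S x = Q x" by (simp add: y_def)
qed

section \<open>Operators on complex Hilbert spaces\<close>

lemma inner_scaleC_left:
  fixes x y :: "'a::complex_inner_space"
  shows "(c *\<^sub>C x) \<bullet> y = x \<bullet> (cnj c *\<^sub>C y)"
proof -
  have "cinner x (cnj c *\<^sub>C y) = cnj (cnj c * cinner y x)"
    by (metis cinner_commute cinner_scaleC_left)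
  also have "\<dots> = c * cinner x y" by (metis cinner_commute complex_cnj_cnj complex_cnj_mult)
  finally show ?thesis by (simp add: inner_eq_Re_cinner cinner_scaleC_left)
qed

lemma cinner_eq_Complex_inner:
  fixes x y :: "'a::complex_inner_space"
  shows "cinner x y = Complex (x \<bullet> y) (- ((\<i> *\<^sub>C x) \<bullet> y))"
  by (simp add: complex_eq_iff inner_eq_Re_cinner cinner_scaleC_left)

lemma norm_scaleC:
  fixes x :: "'a::complex_inner_space"
  shows "norm (c *\<^sub>C x) = cmod c * norm x"
proof (rule power2_eq_imp_eq)
  have "(c *\<^sub>C x) \<bullet> (c *\<^sub>C x) = x \<bullet> (complex_of_real ((cmod c)\<^sup>2) *\<^sub>C x)"
    by (simp add: inner_scaleC_left scaleC_scaleC complex_norm_square mult.commute del: of_real_power)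
  then show "(norm (c *\<^sub>C x))\<^sup>2 = (cmod c * norm x)\<^sup>2"
    by (simp add: power2_norm_eq_inner scaleC_of_real power_mult_distrib del: of_real_power)
qed simp_all

lemma bounded_linear_scaleC: "bounded_linear (\<lambda>x::'a::complex_inner_space. c *\<^sub>C x)"
proof (rule bounded_linear_intro)
  show "c *\<^sub>C r *\<^sub>R x = r *\<^sub>R c *\<^sub>C x" for r and x :: 'a
    by (metis mult.commute scaleC_of_real scaleC_scaleC)
  show "norm (c *\<^sub>C x) \<le> norm x * cmod c" for x :: 'a by (simp add: norm_scaleC)
qed (rule scaleC_add_right)

section \<open>Adjoints, positivity and square roots over the complex numbers\<close>

lemma bounded_ops_iff: "T \<in> bounded_ops \<longleftrightarrow> (\<forall>c x. T (c *\<^sub>C x) = c *\<^sub>C T x)"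
  by (simp add: bounded_ops_def)

lemma bounded_ops_compose: "S \<in> bounded_ops \<Longrightarrow> T \<in> bounded_ops \<Longrightarrow> S o\<^sub>L T \<in> bounded_ops"
  by (simp add: bounded_ops_iff)

lemma real_adjoint_in_bounded_ops:
  fixes S T :: "'a::complex_hilbert_space \<Rightarrow>\<^sub>L 'a"
  assumes T: "T \<in> bounded_ops" and S: "\<And>x y. T x \<bullet> y = x \<bullet> S y"
  shows "S \<in> bounded_ops"
  unfolding bounded_ops_iff
proof (intro allI)
  fix c y
  have "x \<bullet> S (c *\<^sub>C y) = x \<bullet> (c *\<^sub>C S y)" for x
  proof -
    have "x \<bullet> S (c *\<^sub>C y) = T (cnj c *\<^sub>C x) \<bullet> y"
      using T by (simp add: S[symmetric] bounded_ops_iff inner_scaleC_left)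
    then show ?thesis by (simp add: S inner_scaleC_left)
  qed
  then show "S (c *\<^sub>C y) = c *\<^sub>C S y" using vector_eq_ldot by blast
qed

text \<open>Comparing real parts suffices: \<open>T\<close> commutes with multiplication by
  \<open>\<i>\<close>, so the hypothesis at \<open>\<i> *\<^sub>C x\<close> supplies the imaginary
  parts.\<close>

lemma adjoint_op_eqI:
  fixes S T :: "'a::complex_hilbert_space \<Rightarrow>\<^sub>L 'a"
  assumes T: "T \<in> bounded_ops" and S: "\<And>x y. T x \<bullet> y = x \<bullet> S y"
  shows "adjoint_op T = S"
  unfolding adjoint_op_def
proof (rule the_equality)
  show "S \<in> bounded_ops \<and> (\<forall>x y. cinner (T x) y = cinner x (S y))"
  proof (intro conjI allI)
    show "S \<in> bounded_ops" using T S by (rule real_adjoint_in_bounded_ops)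
    fix x y
    have "(\<i> *\<^sub>C T x) \<bullet> y = (\<i> *\<^sub>C x) \<bullet> S y"
      using T S[of "\<i> *\<^sub>C x" y] by (simp add: bounded_ops_iff)
    then show "cinner (T x) y = cinner x (S y)" by (simp add: cinner_eq_Complex_inner S)
  qed
  fix R
  assume "R \<in> bounded_ops \<and> (\<forall>x y. cinner (T x) y = cinner x (R y))"
  then have "x \<bullet> R y = x \<bullet> S y" for x y by (metis S inner_eq_Re_cinner)
  then have "R y = S y" for y using vector_eq_ldot by blast
  then show "R = S" by (rule blinfun_eqI)
qed

lemma inner_adjoint_op:
  fixes T :: "'a::complex_hilbert_space \<Rightarrow>\<^sub>L 'a"
  assumes "T \<in> bounded_ops"
  shows "T x \<bullet> y = x \<bullet> adjoint_op T y"
proof -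
  obtain S :: "'a \<Rightarrow>\<^sub>L 'a" where S: "\<And>x y. T x \<bullet> y = x \<bullet> S y" using real_adjoint_exists[of T] by blast
  then show ?thesis using adjoint_op_eqI[OF assms S] by simp
qed

lemma adjoint_op_in_bounded_ops: "T \<in> bounded_ops \<Longrightarrow> adjoint_op T \<in> bounded_ops"
  by (rule real_adjoint_in_bounded_ops[OF _ inner_adjoint_op])

lemma adjoint_op_adjoint_op:
  assumes "T \<in> bounded_ops"
  shows "adjoint_op (adjoint_op T) = T"
proof (intro adjoint_op_eqI adjoint_op_in_bounded_ops assms)
  show "adjoint_op T x \<bullet> y = x \<bullet> T y" for x y
    using inner_adjoint_op[OF assms, of y x]
    by (subst inner_commute, subst (2) inner_commute) (rule sym)
qed

text \<open>Over the complex numbers, real-valuedness of the quadratic form already forces symmetry.\<close>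

lemma positive_op_iff: "positive_op P \<longleftrightarrow> P \<in> bounded_ops \<and> nonneg_op P"
proof (intro iffI conjI)
  assume P: "positive_op P"
  then show PB: "P \<in> bounded_ops" by (simp add: positive_op_def)
  have im: "(\<i> *\<^sub>C P x) \<bullet> x = 0" for x
    using P unfolding positive_op_def cinner_eq_Complex_inner by (simp add: complex_is_Real_iff)
  have "P x \<bullet> y = x \<bullet> P y" for x y
  proof -
    \<comment> \<open>Polarising the vanishing imaginary part at \<open>z + y\<close> leaves two
      cross terms; the factor \<open>\<i>\<close> in \<open>z\<close> turns them into the two sides
      of the symmetry relation.\<close>
    define z where "z = \<i> *\<^sub>C x"
    have iz: "\<i> *\<^sub>C P z = - P x"
      using PB by (simp add: z_def bounded_ops_iff scaleC_scaleC)
        (metis of_real_1 of_real_minus scaleC_of_real scaleR_minus1_left)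
    have "(\<i> *\<^sub>C P z) \<bullet> y + (\<i> *\<^sub>C P y) \<bullet> z = 0"
      using im[of "z + y"] im[of z] im[of y]
      by (simp add: blinfun.add_right scaleC_add_right inner_add_left inner_add_right)
    moreover have "(\<i> *\<^sub>C P y) \<bullet> z = P y \<bullet> x"
      by (simp add: z_def inner_scaleC_left scaleC_scaleC)
        (metis of_real_1 scaleC_of_real scaleR_one)
    ultimately show ?thesis by (simp add: iz inner_commute)
  qed
  then show "nonneg_op P"
    using P by (simp add: nonneg_op_def positive_op_def inner_eq_Re_cinner)
next
  assume P: "P \<in> bounded_ops \<and> nonneg_op P"
  \<comment> \<open>By symmetry, the imaginary part equals its own negative.\<close>
  have "cinner (P x) x \<in> \<real> \<and> 0 \<le> Re (cinner (P x) x)" for x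
  proof -
    have "(\<i> *\<^sub>C P x) \<bullet> x = P x \<bullet> (- \<i> *\<^sub>C x)" by (simp add: inner_scaleC_left)
    also have "\<dots> = x \<bullet> (- \<i> *\<^sub>C P x)"
      using P by (simp add: nonneg_op_def bounded_ops_iff)
    also have "\<dots> = (\<i> *\<^sub>C x) \<bullet> P x" by (simp add: inner_scaleC_left)
    also have "\<dots> = - ((\<i> *\<^sub>C P x) \<bullet> x)"
    proof -
      have "- \<i> *\<^sub>C x = - (\<i> *\<^sub>C x)"
        by (metis mult_minus1 of_real_1 of_real_minus scaleC_of_real scaleC_scaleC scaleR_minus1_left)
      then show ?thesis using \<open>(\<i> *\<^sub>C P x) \<bullet> x = P x \<bullet> (- \<i> *\<^sub>C x)\<close> by (simp add: inner_commute)
    qed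
    finally have "(\<i> *\<^sub>C P x) \<bullet> x = 0" by simp
    then show ?thesis
      using P nonneg_op_nonneg[of P x] by (simp add: cinner_eq_Complex_inner complex_is_Real_iff)
  qed
  with P show "positive_op P" by (simp add: positive_op_def)
qed

text \<open>The real square root \<open>P\<close> commutes with everything that commutes with
  \<open>A\<close>. Applied to multiplication by a scalar this makes \<open>P\<close>
  complex-linear; applied to another root \<open>Q\<close>, which commutes with \<open>A\<close> as
  its square, it reduces uniqueness to the commuting case.\<close>

lemma sqrt_op_works:
  assumes "positive_op A"
  shows "positive_op (sqrt_op A) \<and> sqrt_op A o\<^sub>L sqrt_op A = A"
    and sqrt_op_eqI: "\<And>Q. positive_op Q \<Longrightarrow> Q o\<^sub>L Q = A \<Longrightarrow> sqrt_op A = Q"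
proof -
  have AB: "A \<in> bounded_ops" and A: "nonneg_op A" using assms by (simp_all add: positive_op_iff)
  from nonneg_op_sqrt_exists[OF A] obtain P where P: "nonneg_op P" "P o\<^sub>L P = A"
    and comm: "\<And>C. A o\<^sub>L C = C o\<^sub>L A \<Longrightarrow> P o\<^sub>L C = C o\<^sub>L P" by blast
  have "P (c *\<^sub>C x) = c *\<^sub>C P x" for c x
  proof -
    define C where "C = Blinfun (\<lambda>x::'a. c *\<^sub>C x)"
    have C: "C y = c *\<^sub>C y" for y
      by (simp add: C_def bounded_linear_Blinfun_apply bounded_linear_scaleC)
    have "A o\<^sub>L C = C o\<^sub>L A" using AB by (intro blinfun_eqI) (simp add: C bounded_ops_iff)
    from comm[OF this] have "(P o\<^sub>L C) x = (C o\<^sub>L P) x" by simp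
    then show ?thesis by (simp add: C)
  qed
  then have pos: "positive_op P" using P by (simp add: positive_op_iff bounded_ops_iff)
  have uniq: "Q = P" if "positive_op Q" "Q o\<^sub>L Q = A" for Q
  proof -
    have "A o\<^sub>L Q = Q o\<^sub>L A" by (simp add: that(2)[symmetric] blinfun_eqI)
    then have "P o\<^sub>L Q = Q o\<^sub>L P" by (rule comm)
    then show ?thesis
      using that P nonneg_op_commuting_sqrt_unique[of P Q] by (simp add: positive_op_iff)
  qed
  have sqrt: "sqrt_op A = P" unfolding sqrt_op_def
    by (rule the_equality) (use pos P uniq in blast)+
  show "positive_op (sqrt_op A) \<and> sqrt_op A o\<^sub>L sqrt_op A = A"
    unfolding sqrt by (intro conjI pos P)
  show "sqrt_op A = Q" if "positive_op Q" "Q o\<^sub>L Q = A" for Q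
    unfolding sqrt by (rule uniq[OF that, symmetric])
qed

section \<open>The modulus and the polar decomposition\<close>

lemma positive_op_adjoint_compose:
  assumes T: "T \<in> bounded_ops"
  shows "positive_op (adjoint_op T o\<^sub>L T)"
proof -
  have "adjoint_op T y \<bullet> x = y \<bullet> T x" for x y
    using inner_adjoint_op[OF T] by (metis inner_commute)
  then show ?thesis
    using T inner_adjoint_op[OF T, symmetric]
    by (simp add: positive_op_iff bounded_ops_compose adjoint_op_in_bounded_ops nonneg_op_def)
qed

lemma abs_op_works:
  assumes T: "T \<in> bounded_ops"
  shows "abs_op T \<in> bounded_ops" "nonneg_op (abs_op T)"
    "abs_op T (abs_op T x) = adjoint_op T (T x)"
proof -
  have *: "positive_op (abs_op T)" "abs_op T o\<^sub>L abs_op T = adjoint_op T o\<^sub>L T"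
    using sqrt_op_works[OF positive_op_adjoint_compose[OF T]] by (simp_all add: abs_op_def)
  then show "abs_op T \<in> bounded_ops" "nonneg_op (abs_op T)" by (simp_all add: positive_op_iff)
  show "abs_op T (abs_op T x) = adjoint_op T (T x)"
    using arg_cong[OF *(2), of "\<lambda>B. blinfun_apply B x"] by simp
qed

lemma inner_abs_op:
  assumes T: "T \<in> bounded_ops"
  shows "abs_op T x \<bullet> abs_op T y = T x \<bullet> T y"
  using nonneg_op_symmetric[OF abs_op_works(2)[OF T], of x "abs_op T y"]
    inner_adjoint_op[OF T, of x "T y"] by (simp only: abs_op_works(3)[OF T])

lemma norm_abs_op:
  assumes "T \<in> bounded_ops"
  shows "norm (abs_op T x) = norm (T x)"
  unfolding norm_eq by (rule inner_abs_op[OF assms])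

text \<open>The adjoint \<open>W\<close> of the polar factor is constructed first: \<open>W y\<close> is the vector of the closed
  range of \<open>|T|\<close> representing the functional \<open>|T| x \<mapsto> \<langle>y, T x\<rangle>\<close>.\<close>

lemma polar_adjoint_exists:
  fixes T :: "'a::complex_hilbert_space \<Rightarrow>\<^sub>L 'a"
  assumes T: "T \<in> bounded_ops"
  obtains U W :: "'a \<Rightarrow>\<^sub>L 'a" where "U \<in> bounded_ops" "\<And>x y. U x \<bullet> y = x \<bullet> W y"
    "\<And>y. W y \<in> closure (range (abs_op T))"
    "\<And>x. U (abs_op T x) = T x" "\<And>x. W (T x) = abs_op T x"
proof -
  have "norm (T x) \<le> 1 * norm (abs_op T x)" for x by (simp add: norm_abs_op[OF T])
  from blinfun_factor_through_range[OF this zero_le_one] obtain W :: "'a \<Rightarrow>\<^sub>L 'a"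
    where W_in: "\<And>y. W y \<in> closure (range (abs_op T))"
      and W: "\<And>x y. y \<bullet> T x = W y \<bullet> abs_op T x" by blast
  have sub: "subspace (closure (range (abs_op T)))" by (rule subspace_closure_range_blinfun)
  have uniq: "m = n"
    if "m \<in> closure (range (abs_op T))" "n \<in> closure (range (abs_op T))"
      "\<And>x. m \<bullet> abs_op T x = n \<bullet> abs_op T x" for m n
    using closure_inter_orthogonal_eq_zero[of "m - n" "range (abs_op T)"] that sub
    by (auto simp: subspace_diff inner_diff_left)
  have WT: "W (T x) = abs_op T x" for x
  proof (intro uniq W_in)
    show "abs_op T x \<in> closure (range (abs_op T))"
      using closure_subset[of "range (abs_op T)"] by auto
    show "W (T x) \<bullet> abs_op T z = abs_op T x \<bullet> abs_op T z" for z
      by (simp add: W[symmetric] inner_abs_op[OF T])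
  qed
  obtain U :: "'a \<Rightarrow>\<^sub>L 'a" where U: "\<And>x y. W x \<bullet> y = x \<bullet> U y"
    using real_adjoint_exists[of W] by blast
  have UA: "U (abs_op T x) = T x" for x
  proof -
    have "y \<bullet> U (abs_op T x) = y \<bullet> T x" for y by (simp add: U[symmetric] W)
    then show ?thesis using vector_eq_ldot by blast
  qed
  have UW: "U x \<bullet> y = x \<bullet> W y" for x y using U[of y x] by (metis inner_commute)
  \<comment> \<open>Both \<open>W (c *\<^sub>C y)\<close> and \<open>c *\<^sub>C W y\<close> lie in
    the closed range of |T| and represent the same functional there, so they agree.\<close>
  have "W \<in> bounded_ops" unfolding bounded_ops_iff
  proof (intro allI uniq)
    fix c y x
    show "c *\<^sub>C W y \<in> closure (range (abs_op T))"
    proof -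
      have "closed ((\<lambda>z. c *\<^sub>C z) -` closure (range (abs_op T)))"
        by (intro closed_vimage closed_closure linear_continuous_on bounded_linear_scaleC)
      moreover have "range (abs_op T) \<subseteq> (\<lambda>z. c *\<^sub>C z) -` closure (range (abs_op T))"
      proof clarsimp
        fix z
        have "c *\<^sub>C abs_op T z = abs_op T (c *\<^sub>C z)"
          using abs_op_works(1)[OF T] by (simp add: bounded_ops_iff)
        then show "c *\<^sub>C abs_op T z \<in> closure (range (abs_op T))"
          using closure_subset[of "range (abs_op T)"] by auto
      qed
      ultimately show ?thesis using W_in closure_minimal by blast
    qed
    have "W (c *\<^sub>C y) \<bullet> abs_op T x = y \<bullet> T (cnj c *\<^sub>C x)"
      using T by (simp add: W[symmetric] inner_scaleC_left bounded_ops_iff)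
    also have "\<dots> = (c *\<^sub>C W y) \<bullet> abs_op T x"
      using abs_op_works(1)[OF T] by (simp add: W inner_scaleC_left bounded_ops_iff)
    finally show "W (c *\<^sub>C y) \<bullet> abs_op T x = (c *\<^sub>C W y) \<bullet> abs_op T x" .
  qed (rule W_in)
  then have "U \<in> bounded_ops" using U by (rule real_adjoint_in_bounded_ops)
  then show thesis using UW W_in UA WT by (rule that)
qed

text \<open>Since \<open>polar_factor\<close> is a definite description, the explicit
  \<open>U\<close> must be shown to satisfy it and to be the only such operator. Both follow from
  the orthogonal splitting of the space into the closed range of |T| and the kernel of
  \<open>T\<close>.\<close>

lemma polar_factor_in_bounded_ops:
  fixes T :: "'a::complex_hilbert_space \<Rightarrow>\<^sub>L 'a"
  assumes T: "T \<in> bounded_ops"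
  shows "polar_factor T \<in> bounded_ops"
proof -
  obtain U W :: "'a \<Rightarrow>\<^sub>L 'a" where U: "U \<in> bounded_ops" and UW: "\<And>x y. U x \<bullet> y = x \<bullet> W y"
    and W_in: "\<And>y. W y \<in> closure (range (abs_op T))"
    and UA: "\<And>x. U (abs_op T x) = T x"
    by (rule polar_adjoint_exists[OF T]) blast
  have sa: "abs_op T x \<bullet> y = x \<bullet> abs_op T y" for x y
    using abs_op_works(2)[OF T] by (simp add: nonneg_op_def)
  have isometric: "norm (U z) = norm z" if "z \<in> closure (range (abs_op T))" for z
  proof -
    have "closed {z. norm (U z) = norm z}"
      by (intro closed_Collect_eq continuous_intros)
    then have "closure (range (abs_op T)) \<subseteq> {z. norm (U z) = norm z}"
      by (intro closure_minimal) (auto simp: UA norm_abs_op[OF T])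
    with that show ?thesis by blast
  qed
  have ker_abs: "x \<in> ker_op T \<longleftrightarrow> (\<forall>y. x \<bullet> abs_op T y = 0)" for x
    using norm_abs_op[OF T, of x] by (simp add: ker_op_def flip: sa)
      (metis inner_zero_left inner_eq_zero_iff norm_eq_zero)
  \<comment> \<open>Here \<open>U x \<bullet> U x\<close> equals \<open>x \<bullet> W (U x)\<close>,
    and \<open>W (U x)\<close> lies in the closed range of |T|, which is orthogonal to the
    kernel.\<close>
  have U_ker: "U x = 0" if "x \<in> ker_op T" for x
  proof -
    have "closed {z. x \<bullet> z = 0}" by (intro closed_Collect_eq continuous_intros)
    then have "closure (range (abs_op T)) \<subseteq> {z. x \<bullet> z = 0}"
      using that ker_abs by (intro closure_minimal) auto
    then have "U x \<bullet> U x = 0" using W_in[of "U x"] UW by auto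
    then show ?thesis by simp
  qed
  have decomp: "\<exists>p q. x = p + q \<and> p \<in> closure (range (abs_op T)) \<and> q \<in> ker_op T" for x
  proof -
    obtain p where "p \<in> closure (range (abs_op T))" "\<And>y. (x - p) \<bullet> abs_op T y = 0"
      using orthogonal_decomposition_range by blast
    then show ?thesis using ker_abs
      by (intro exI[of _ p] exI[of _ "x - p"]) auto
  qed
  have ker_eq: "ker_op U = ker_op T"
  proof
    show "ker_op T \<subseteq> ker_op U" using U_ker by (auto simp: ker_op_def)
    show "ker_op U \<subseteq> ker_op T"
    proof
      fix x assume "x \<in> ker_op U"
      moreover obtain p q where pq: "x = p + q" "p \<in> closure (range (abs_op T))" "q \<in> ker_op T"
        using decomp by blast
      ultimately have "U p = 0" using U_ker[OF pq(3)] by (simp add: ker_op_def blinfun.add_right)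
      with isometric[OF pq(2)] pq show "x \<in> ker_op T" by simp
    qed
  qed
  have iso: "partial_isometry U" unfolding partial_isometry_def
  proof (intro conjI U allI impI)
    fix x assume x: "\<forall>y\<in>ker_op U. cinner x y = 0"
    obtain p q where pq: "x = p + q" "p \<in> closure (range (abs_op T))" "q \<in> ker_op T"
      using decomp by blast
    have "x \<bullet> q = 0" using x pq(3) ker_eq by (simp add: inner_eq_Re_cinner)
    moreover have "p \<bullet> q = 0"
    proof -
      have "closed {z. z \<bullet> q = 0}" by (intro closed_Collect_eq continuous_intros)
      then have "closure (range (abs_op T)) \<subseteq> {z. z \<bullet> q = 0}"
        using pq(3) ker_abs by (intro closure_minimal) (auto simp: inner_commute)
      with pq(2) show ?thesis by blast
    qed
    ultimately have "q = 0" using pq(1) by (simp add: inner_add_left)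
    with pq isometric show "norm (U x) = norm x" by simp
  qed
  have factors: "T = U o\<^sub>L abs_op T" by (rule blinfun_eqI) (simp add: UA)
  \<comment> \<open>The factorisation fixes \<open>V\<close> on the range of |T|, continuity extends
    this to the closure, and the kernel condition settles the complement.\<close>
  have unique: "V = U" if ker: "ker_op V = ker_op T" and fac: "T = V o\<^sub>L abs_op T" for V
  proof (rule blinfun_eqI)
    fix x
    obtain p q where pq: "x = p + q" "p \<in> closure (range (abs_op T))" "q \<in> ker_op T"
      using decomp by blast
    have "closed {z. V z = U z}" by (intro closed_Collect_eq continuous_intros)
    moreover have "V (abs_op T z) = U (abs_op T z)" for z
      using arg_cong[OF fac, of "\<lambda>B. blinfun_apply B z"] UA by simp
    ultimately have "closure (range (abs_op T)) \<subseteq> {z. V z = U z}"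
      by (intro closure_minimal) auto
    then have "V p = U p" using pq(2) by blast
    moreover have "V q = 0" using pq(3) ker by (auto simp: ker_op_def)
    ultimately show "V x = U x" using U_ker[OF pq(3)] by (simp add: pq(1) blinfun.add_right)
  qed
  have "polar_factor T = U"
    unfolding polar_factor_def
  proof (rule the_equality)
    show "partial_isometry U \<and> ker_op U = ker_op T \<and> T = U o\<^sub>L abs_op T"
      by (intro conjI iso ker_eq factors)
  qed (blast intro: unique)
  with U show ?thesis by simp
qed

lemma duggal_transform_in_bounded_ops:
  "T \<in> bounded_ops \<Longrightarrow> duggal_transform T \<in> bounded_ops"
  unfolding duggal_transform_def
  by (intro bounded_ops_compose abs_op_works(1) polar_factor_in_bounded_ops)

section \<open>The norm inequality\<close>

text \<open>The point is that \<open>|T\<^sup>*| = U |T| U\<^sup>*\<close>, so that the Cauchy-Schwarz inequality for the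
  semi-inner product \<open>\<langle>|T| x, y\<rangle>\<close> applies to \<open>\<langle>T x, y\<rangle> = \<langle>|T| x, U\<^sup>* y\<rangle>\<close>.\<close>

lemma mixed_Cauchy_Schwarz:
  fixes T :: "'a::complex_hilbert_space \<Rightarrow>\<^sub>L 'a"
  assumes T: "T \<in> bounded_ops"
  shows "(T x \<bullet> y)\<^sup>2 \<le> (abs_op T x \<bullet> x) * (abs_op (adjoint_op T) y \<bullet> y)"
proof -
  obtain U W :: "'a \<Rightarrow>\<^sub>L 'a" where U: "U \<in> bounded_ops" and UW: "\<And>x y. U x \<bullet> y = x \<bullet> W y"
    and UA: "\<And>x. U (abs_op T x) = T x" and WT: "\<And>x. W (T x) = abs_op T x"
    by (rule polar_adjoint_exists[OF T]) blast
  have WB: "W \<in> bounded_ops" using U UW by (rule real_adjoint_in_bounded_ops)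
  have A: "nonneg_op (abs_op T)" by (rule abs_op_works(2)[OF T])
  have UAW: "U (abs_op T z) \<bullet> w = abs_op T z \<bullet> W w" for z w by (simp add: UW)
  have adj: "adjoint_op T z = abs_op T (W z)" for z
  proof -
    have "w \<bullet> adjoint_op T z = w \<bullet> abs_op T (W z)" for w
      using A inner_adjoint_op[OF T, of w z] UAW[of w z] by (simp add: UA nonneg_op_def)
    then show ?thesis using vector_eq_ldot by blast
  qed
  define Q where "Q = U o\<^sub>L abs_op T o\<^sub>L W"
  have Q: "Q z = T (W z)" for z by (simp add: Q_def UA)
  have Q_inner: "Q z \<bullet> w = abs_op T (W z) \<bullet> W w" for z w
    by (simp add: Q_def UW)
  have "abs_op (adjoint_op T) = Q"
    unfolding abs_op_def
  proof (rule sqrt_op_eqI)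
    show "positive_op (adjoint_op (adjoint_op T) o\<^sub>L adjoint_op T)"
      by (intro positive_op_adjoint_compose adjoint_op_in_bounded_ops T)
    have "Q \<in> bounded_ops"
      unfolding Q_def by (intro bounded_ops_compose U WB abs_op_works(1) T)
    moreover have "nonneg_op Q"
      using A unfolding nonneg_op_def by (metis Q_inner inner_commute)
    ultimately show "positive_op Q" by (simp add: positive_op_iff)
    \<comment> \<open>Since \<open>Q z = T (W z)\<close> and \<open>W (T x)\<close> = |T| x, the
      square of \<open>Q\<close> sends \<open>z\<close> to T (|T| (W z)), which is
      \<open>T (adjoint_op T z)\<close>.\<close>
    show "Q o\<^sub>L Q = adjoint_op (adjoint_op T) o\<^sub>L adjoint_op T"
      by (rule blinfun_eqI) (simp add: Q adjoint_op_adjoint_op T adj WT)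
  qed
  then have "abs_op (adjoint_op T) y \<bullet> y = abs_op T (W y) \<bullet> W y" by (simp add: Q_inner)
  moreover have "T x \<bullet> y = abs_op T x \<bullet> W y" using UAW[of x y] by (simp add: UA)
  ultimately show ?thesis using nonneg_op_Cauchy_Schwarz[OF A, of x "W y"] by simp
qed

lemma weighted_sum_Cauchy_Schwarz:
  fixes a b c d r s t u :: real
  assumes "0 \<le> a" "0 \<le> b" "0 \<le> c" "0 \<le> d" "0 \<le> r" "0 \<le> s"
    and t: "t\<^sup>2 \<le> a * b" and u: "u\<^sup>2 \<le> c * d"
  shows "r * t + s * u \<le> sqrt ((r * a + s * c) * (r * b + s * d))"
proof -
  have "t \<le> sqrt a * sqrt b" "u \<le> sqrt c * sqrt d"
    using t u by (simp_all add: real_le_rsqrt flip: real_sqrt_mult)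
  then have "r * t + s * u \<le> r * (sqrt a * sqrt b) + s * (sqrt c * sqrt d)"
    using assms by (intro add_mono mult_left_mono)
  also have "\<dots> \<le> sqrt ((r * a + s * c) * (r * b + s * d))"
  proof (rule real_le_rsqrt)
    have sq: "a = (sqrt a)\<^sup>2" "b = (sqrt b)\<^sup>2" "c = (sqrt c)\<^sup>2" "d = (sqrt d)\<^sup>2" using assms by simp_all
    \<comment> \<open>Lagrange's identity: the defect in the planar Cauchy-Schwarz inequality is a
      square with weight \<open>r * s\<close>.\<close>
    have "(r * a + s * c) * (r * b + s * d) - (r * (sqrt a * sqrt b) + s * (sqrt c * sqrt d))\<^sup>2
        = r * s * (sqrt a * sqrt d - sqrt c * sqrt b)\<^sup>2"
      by (subst (1) sq(1), subst (1) sq(2), subst (1) sq(3), subst (1) sq(4)) algebra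
    moreover have "0 \<le> r * s * (sqrt a * sqrt d - sqrt c * sqrt b)\<^sup>2" using assms by simp
    ultimately show "(r * (sqrt a * sqrt b) + s * (sqrt c * sqrt d))\<^sup>2
        \<le> (r * a + s * c) * (r * b + s * d)" by linarith
  qed
  finally show ?thesis .
qed

text \<open>The weights enter both factors of the planar inequality, so the quadratic forms
  recombine into those of \<open>?P\<close> and \<open>?Q\<close> before norms are taken. This keeps
  norms of sums rather than sums of norms.\<close>

lemma inner_weighted_sum_le:
  assumes T: "T \<in> bounded_ops" and D: "D \<in> bounded_ops" and rs: "0 \<le> r" "0 \<le> s"
  shows "r * (T x \<bullet> y) + s * (D x \<bullet> y)
    \<le> sqrt (norm (r *\<^sub>R abs_op T + s *\<^sub>R abs_op D)
          * norm (r *\<^sub>R abs_op (adjoint_op T) + s *\<^sub>R abs_op (adjoint_op D))) * (norm x * norm y)"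
    (is "_ \<le> sqrt (norm ?P * norm ?Q) * _")
proof -
  have nn: "0 \<le> abs_op S z \<bullet> z" if "S \<in> bounded_ops" for S :: "'a \<Rightarrow>\<^sub>L 'a" and z
    by (rule nonneg_op_nonneg[OF abs_op_works(2)[OF that]])
  note TD = T D adjoint_op_in_bounded_ops[OF T] adjoint_op_in_bounded_ops[OF D]
  have P: "r * (abs_op T x \<bullet> x) + s * (abs_op D x \<bullet> x) = ?P x \<bullet> x"
    and Q: "r * (abs_op (adjoint_op T) y \<bullet> y) + s * (abs_op (adjoint_op D) y \<bullet> y) = ?Q y \<bullet> y"
    by (simp_all add: blinfun.bilinear_simps inner_add_left)
  have "r * (T x \<bullet> y) + s * (D x \<bullet> y) \<le> sqrt ((?P x \<bullet> x) * (?Q y \<bullet> y))"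
    unfolding P[symmetric] Q[symmetric]
    by (intro weighted_sum_Cauchy_Schwarz nn TD rs mixed_Cauchy_Schwarz)
  also have "\<dots> \<le> sqrt ((norm ?P * (norm x)\<^sup>2) * (norm ?Q * (norm y)\<^sup>2))"
  proof (intro real_sqrt_le_mono mult_mono inner_blinfun_le_norm)
    show "0 \<le> ?Q y \<bullet> y"
      unfolding Q[symmetric] by (intro add_nonneg_nonneg mult_nonneg_nonneg rs nn TD)
  qed simp
  also have "\<dots> = sqrt (norm ?P * norm ?Q) * (norm x * norm y)"
    by (simp add: real_sqrt_mult)
  finally show ?thesis .
qed

lemma norm_convex_combination_le:
  assumes T: "T \<in> bounded_ops" and D: "D \<in> bounded_ops" and l: "0 \<le> l" "l \<le> 1"
  shows "norm (l *\<^sub>R T + (1 - l) *\<^sub>R D)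
    \<le> sqrt (norm (l\<^sup>2 *\<^sub>R abs_op T + (1 - l)\<^sup>2 *\<^sub>R abs_op D)
          * norm (l\<^sup>2 *\<^sub>R abs_op (adjoint_op T) + (1 - l)\<^sup>2 *\<^sub>R abs_op (adjoint_op D)))
      + l * (1 - l) * sqrt (norm (abs_op T + abs_op D)
          * norm (abs_op (adjoint_op T) + abs_op (adjoint_op D)))"
    (is "norm ?M \<le> ?a + l * (1 - l) * ?b")
proof (rule norm_blinfun_bound)
  show "0 \<le> ?a + l * (1 - l) * ?b"
    using l by (intro add_nonneg_nonneg mult_nonneg_nonneg real_sqrt_ge_zero norm_ge_zero) simp_all
  fix x
  \<comment> \<open>Testing against the image itself makes the real inner product equal to
    \<open>norm y * norm y\<close>; one factor \<open>norm y\<close> is cancelled at the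
    end.\<close>
  define y where "y = ?M x"
  then have y: "y = l *\<^sub>R T x + (1 - l) *\<^sub>R D x" by (simp add: blinfun.bilinear_simps)
  have "norm y * norm y = y \<bullet> y" by (simp flip: power2_eq_square power2_norm_eq_inner)
  also have "\<dots> = l * (T x \<bullet> y) + (1 - l) * (D x \<bullet> y)"
    by (subst (1) y) (simp add: inner_add_left)
  also have "\<dots> = (l\<^sup>2 * (T x \<bullet> y) + (1 - l)\<^sup>2 * (D x \<bullet> y))
      + l * (1 - l) * (1 * (T x \<bullet> y) + 1 * (D x \<bullet> y))"
    by (simp add: power2_eq_square algebra_simps)
  also have "\<dots> \<le> ?a * (norm x * norm y) + l * (1 - l) * (?b * (norm x * norm y))"
  proof (intro add_mono mult_left_mono)
    show "l\<^sup>2 * (T x \<bullet> y) + (1 - l)\<^sup>2 * (D x \<bullet> y) \<le> ?a * (norm x * norm y)"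
      by (rule inner_weighted_sum_le[OF T D]) simp_all
    show "1 * (T x \<bullet> y) + 1 * (D x \<bullet> y) \<le> ?b * (norm x * norm y)"
      using inner_weighted_sum_le[OF T D, of 1 1 x y] by simp
    show "0 \<le> l * (1 - l)" using l by simp
  qed
  also have "\<dots> = (?a + l * (1 - l) * ?b) * norm x * norm y" by (simp add: algebra_simps)
  finally show "norm (?M x) \<le> (?a + l * (1 - l) * ?b) * norm x"
    unfolding y_def[symmetric] using l
    by (cases "y = 0") (simp_all add: mult_le_cancel_right)
qed

theorem theorem18:
  fixes T :: "'a::complex_hilbert_space \<Rightarrow>\<^sub>L 'a"
  assumes "T \<in> bounded_ops"
  shows "(\<forall>l\<in>{0..1::real}.
            norm (lambda_mean_transform l T)
              \<le> sqrt (norm (l\<^sup>2 *\<^sub>R abs_op T + (1 - l)\<^sup>2 *\<^sub>R abs_op (duggal_transform T))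
                    * norm (l\<^sup>2 *\<^sub>R abs_op (adjoint_op T)
                            + (1 - l)\<^sup>2 *\<^sub>R abs_op (adjoint_op (duggal_transform T))))
                + l * (1 - l)
                  * sqrt (norm (abs_op T + abs_op (duggal_transform T))
                        * norm (abs_op (adjoint_op T) + abs_op (adjoint_op (duggal_transform T)))))
         \<and> norm (mean_transform T)
              \<le> 1/2 * sqrt (norm (abs_op T + abs_op (duggal_transform T))
                        * norm (abs_op (adjoint_op T) + abs_op (adjoint_op (duggal_transform T))))"
proof -
  note D = duggal_transform_in_bounded_ops[OF assms]
  \<comment> \<open>At \<open>l = 1/2\<close> both squared weights are 1/4, so the first root is a
    quarter of the second; the coefficient \<open>l * (1 - l)\<close> is 1/4 as well, and the two
    terms add up to one half.\<close>
  have "norm ((1/2) *\<^sub>R (1/2) *\<^sub>R (X + Y)) = norm (X + Y) / 4" for X Y :: "'a \<Rightarrow>\<^sub>L 'a"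
    by simp
  then have quarter: "norm ((1/2)\<^sup>2 *\<^sub>R X + (1 - 1/2)\<^sup>2 *\<^sub>R Y) = norm (X + Y) / 4" for X Y :: "'a \<Rightarrow>\<^sub>L 'a"
    by (simp add: power2_eq_square scaleR_add_right)
  have sqrt4: "sqrt (p / 4 * (q / 4)) = sqrt (p * q) / 4" for p q :: real
    by (simp add: real_sqrt_divide real_sqrt_mult)
  show ?thesis
    using norm_convex_combination_le[OF assms D]
      norm_convex_combination_le[OF assms D, of "1/2", unfolded quarter sqrt4]
    by (simp add: mean_transform_def lambda_mean_transform_def)
qed

end
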